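(* Let $G$ be a graph, and suppose $S\subseteq V(G)$. 1. $M_A(G[S])$ is the matroid on $S$ with family of bases $$\mathcal{B}(M_A(G[S]))=\{\text{maximal } B\subseteq S\mid B\in\mathcal{D}_G\}.$$ 2. $M_A(G[S])$ is the matroid on $S$ with family of independent sets $$\mathcal{I}(M_A(G[S]))=\{I\subseteq S\mid \text{there is some } X\in\mathcal{D}_G\text{ with } I\subseteq X\subseteq S\}.$$ 3. $\mathcal{D}_{G[S]}$ is the $\Delta$-matroid $(S,\sigma)$ with $$\sigma=\bigcup_{T\subseteq S}\mathcal{B}(M_A(G[T])).$$
   Context: Graphs are finite and may have loops and parallel edges. $\mathcal{A}(G)$ is the symmetric $V(G)\times V(G)$ matrix over $GF(2)$ with $a_{vv}=1$ iff $v$ is looped and, for $v\ne w$, $a_{vw}=1$ iff $v,w$ are adjacent. $G[S]$ is the full subgraph of $G$ induced by $S$. The adjacency matroid $M_A(G)$ is the binary matroid on $V(G)$ whose circuits are the minimal nonempty $S\subseteq V(G)$ such that the columns of $\mathcal{A}(G)$ indexed by $S$ are linearly dependent over $GF(2)$. $\mathcal{I}(M)$ and $\mathcal{B}(M)$ denote the families of independent sets (sets containing no circuit) and bases (maximal independent sets) of a matroid $M$. A $\Delta$-matroid is a pair $D=(V,\sigma)$ with $V$ a finite set and $\sigma\subseteq 2^V$ nonempty such that for all $X,Y\in\sigma$ and all $u\in X\Delta Y$, either $X\Delta\{u\}\in\sigma$ or there is $v\neq u$ in $X\Delta Y$ with $X\Delta\{u,v\}\in\sigma$ (or both); $X\in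 D$ means $X\in\sigma$. The $\Delta$-matroid of a graph $G$ is $\mathcal{D}_G=(V(G),\{S\subseteq V(G)\mid \mathcal{A}(G[S])\text{ is nonsingular over }GF(2)\})$, where the empty matrix is nonsingular by convention. Maximality in part 1 is with respect to inclusion among the subsets of $S$ that belong to $\mathcal{D}_G$. *)

theory Defs
  imports Main "HOL-Library.Z2"
begin

record ('v, 'e) multigraph =
  verts :: "'v set"
  edges :: "'e set"
  ends :: "'e \<Rightarrow> 'v set"

text \<open>An edge whose set of ends is a singleton is a loop.\<close>

definition fin_multigraph :: "('v, 'e) multigraph \<Rightarrow> bool" where
  "fin_multigraph G \<longleftrightarrow> finite (verts G) \<and> finite (edges G) \<and>
     (\<forall>e\<in>edges G. ends G e \<subseteq> verts G \<and> (card (ends G e) = 1 \<or> card (ends G e) = 2))"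

definition looped :: "('v, 'e) multigraph \<Rightarrow> 'v \<Rightarrow> bool" where
  "looped G v \<longleftrightarrow> (\<exists>e\<in>edges G. ends G e = {v})"

definition adjacent :: "('v, 'e) multigraph \<Rightarrow> 'v \<Rightarrow> 'v \<Rightarrow> bool" where
  "adjacent G v w \<longleftrightarrow> v \<noteq> w \<and> (\<exists>e\<in>edges G. ends G e = {v, w})"

definition induced_subgraph :: "('v, 'e) multigraph \<Rightarrow> 'v set \<Rightarrow> ('v, 'e) multigraph" where
  "induced_subgraph G S = \<lparr>verts = S, edges = {e \<in> edges G. ends G e \<subseteq> S}, ends = ends G\<rparr>"

text \<open>Matrices whose rows and columns are both indexed by a finite set \<open>V\<close> are represented by
  functions of two arguments, of which only the values on \<open>V \<times> V\<close> matter.  The type \<open>bit\<close> is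
  the field with two elements.\<close>

definition adj_matrix :: "('v, 'e) multigraph \<Rightarrow> 'v \<Rightarrow> 'v \<Rightarrow> bit" where
  "adj_matrix G v w = (if v = w then of_bool (looped G v) else of_bool (adjacent G v w))"

text \<open>Dependence of the family of columns (not of the set of columns): two equal columns with
  different indices are dependent.\<close>

definition dependent_columns :: "'v set \<Rightarrow> ('v \<Rightarrow> 'v \<Rightarrow> 'k::field) \<Rightarrow> 'v set \<Rightarrow> bool" where
  "dependent_columns V A S \<longleftrightarrow>
     (\<exists>c. (\<exists>s\<in>S. c s \<noteq> 0) \<and> (\<forall>v\<in>V. (\<Sum>s\<in>S. c s * A v s) = 0))"

text \<open>Existence of a two-sided inverse; the empty matrix is nonsingular.\<close>

definition nonsingular_on :: "'v set \<Rightarrow> ('v \<Rightarrow> 'v \<Rightarrow> 'k::field) \<Rightarrow> bool" where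
  "nonsingular_on V A \<longleftrightarrow>
     (\<exists>B. (\<forall>v\<in>V. \<forall>w\<in>V. (\<Sum>u\<in>V. A v u * B u w) = (if v = w then 1 else 0)) \<and>
          (\<forall>v\<in>V. \<forall>w\<in>V. (\<Sum>u\<in>V. B v u * A u w) = (if v = w then 1 else 0)))"

definition minimal_sets :: "'a set set \<Rightarrow> 'a set set" where
  "minimal_sets F = {X \<in> F. \<forall>Y\<in>F. Y \<subseteq> X \<longrightarrow> Y = X}"

definition maximal_sets :: "'a set set \<Rightarrow> 'a set set" where
  "maximal_sets F = {X \<in> F. \<forall>Y\<in>F. X \<subseteq> Y \<longrightarrow> Y = X}"

text \<open>Matroids are presented by their circuits.\<close>

record 'a matroid =
  ground :: "'a set"
  circuits :: "'a set set"

definition is_matroid :: "'a matroid \<Rightarrow> bool" where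
  "is_matroid M \<longleftrightarrow> finite (ground M) \<and> circuits M \<subseteq> Pow (ground M) \<and> {} \<notin> circuits M \<and>
     (\<forall>C\<in>circuits M. \<forall>D\<in>circuits M. C \<subseteq> D \<longrightarrow> C = D) \<and>
     (\<forall>C\<in>circuits M. \<forall>D\<in>circuits M. \<forall>x\<in>C \<inter> D. C \<noteq> D \<longrightarrow>
        (\<exists>E\<in>circuits M. E \<subseteq> (C \<union> D) - {x}))"

definition indep_sets :: "'a matroid \<Rightarrow> 'a set set" where
  "indep_sets M = {I. I \<subseteq> ground M \<and> \<not> (\<exists>C\<in>circuits M. C \<subseteq> I)}"

definition bases :: "'a matroid \<Rightarrow> 'a set set" where
  "bases M = maximal_sets (indep_sets M)"

definition adjacency_matroid :: "('v, 'e) multigraph \<Rightarrow> 'v matroid" where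
  "adjacency_matroid G =
     \<lparr>ground = verts G,
      circuits = minimal_sets
        {S. S \<noteq> {} \<and> S \<subseteq> verts G \<and> dependent_columns (verts G) (adj_matrix G) S}\<rparr>"

type_synonym 'a set_system = "'a set \<times> 'a set set"

definition is_delta_matroid :: "'a set_system \<Rightarrow> bool" where
  "is_delta_matroid D \<longleftrightarrow> finite (fst D) \<and> snd D \<subseteq> Pow (fst D) \<and> snd D \<noteq> {} \<and>
     (\<forall>X\<in>snd D. \<forall>Y\<in>snd D. \<forall>u\<in>sym_diff X Y.
        sym_diff X {u} \<in> snd D \<or> (\<exists>v\<in>sym_diff X Y. v \<noteq> u \<and> sym_diff X {u, v} \<in> snd D))"

definition graph_delta_matroid :: "('v, 'e) multigraph \<Rightarrow> 'v set_system" where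
  "graph_delta_matroid G =
     (verts G, {S. S \<subseteq> verts G \<and> nonsingular_on S (adj_matrix (induced_subgraph G S))})"

end

theory Submission
  imports Defs
begin

text \<open>Inducing a subgraph only restricts the adjacency matrix, so everything is a statement about one
  symmetric matrix \<open>A\<close> and its principal submatrices \<open>A[X]\<close>.  A square matrix is nonsingular
  exactly when its columns are independent (\<open>nonsingular_on_iff_independent_columns\<close>), so
  \<open>X \<in> \<D>\<^sub>G\<close> means that the columns \<open>X\<close> of \<open>A[X]\<close> are independent, whereas \<open>I\<close> is
  independent in \<open>M\<^sub>A(G[S])\<close> when the columns \<open>I\<close> of \<open>A[S]\<close> are.  In the statements below
  these are \<open>\<not> dependent_columns X A X\<close> and \<open>\<not> dependent_columns S A I\<close>.

  If \<open>I \<subseteq> X \<subseteq> S\<close> and \<open>A[X]\<close> is nonsingular, then \<open>I\<close> is independent: fewer rows and more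
  columns can only create dependences.  Conversely a maximal independent set \<open>B\<close> of columns of
  \<open>A[S]\<close> spans all of its columns; by symmetry the rows \<open>B\<close> span all of its rows, so a vector
  supported on \<open>B\<close> that is killed by \<open>A[B]\<close> is killed by all of \<open>A[S]\<close> and hence zero.  Thus
  \<open>A[B]\<close> is nonsingular (\<open>maximal_independent_columns_principal\<close>).  So the independent sets are
  the subsets of the members of \<open>\<D>\<^sub>G\<close> contained in \<open>S\<close>, and the bases are the maximal such
  members.  The description of \<open>\<D>\<^bsub>G[S]\<^esub>\<close> by bases follows, because a member \<open>X\<close> is the largest
  possible, hence a maximal, member inside \<open>X\<close> itself.

  The exchange axiom is a fact about the graph \<open>{(x, A x)}\<close> of \<open>A\<close>, a Lagrangian subspace because
  \<open>A\<close> is symmetric.  Choose from each pair of coordinates \<open>x\<^sub>v, (A x)\<^sub>v\<close> the second one for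
  \<open>v \<in> X\<close> and the first one for \<open>v \<notin> X\<close>; then \<open>A[X]\<close> is nonsingular iff the chosen
  coordinates determine the vector (\<open>principal_iff_pivot_input_injective\<close>).  Take the vector whose
  chosen coordinates form the unit vector at \<open>u\<close>: its remaining coordinates show which exchanges
  are possible (\<open>principal_symmetric_exchange\<close>).\<close>

section \<open>Linear systems over a field\<close>

text \<open>Gaussian elimination, one row at a time.  Rows and columns have separate index types so that a
  square system can be augmented by a column that carries a new index.\<close>

lemma wide_system_has_nonzero_solution:
  fixes A :: "'r \<Rightarrow> 'c \<Rightarrow> 'k::field"
  assumes "finite R" "finite C" "card R < card C"
  shows "\<exists>c. (\<exists>s\<in>C. c s \<noteq> 0) \<and> (\<forall>r\<in>R. (\<Sum>s\<in>C. c s * A r s) = 0)"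
  using assms
proof (induction R arbitrary: C A rule: finite_induct)
  case empty
  then obtain s where "s \<in> C" by fastforce
  then show ?case by (auto intro!: exI[of _ "\<lambda>_. 1"])
next
  case (insert r R)
  show ?case
  proof (cases "\<forall>s\<in>C. A r s = 0")
    case True
    have "card R < card C" using insert by simp
    from insert.IH[OF insert.prems(1) this, of A] True show ?thesis by auto
  next
    case False
    then obtain p where p: "p \<in> C" "A r p \<noteq> 0" by auto
    have "card R < card (C - {p})" using insert p by simp
    then obtain c where nz: "\<exists>s\<in>C - {p}. c s \<noteq> 0"
      and c: "\<forall>q\<in>R. (\<Sum>s\<in>C - {p}. c s * (A q s - A q p * A r s / A r p)) = 0"
      using insert.IH[of "C - {p}" "\<lambda>q s. A q s - A q p * A r s / A r p"] insert.prems by auto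
    \<comment> \<open>The value at the pivot is forced by the equation of the row \<open>r\<close>.\<close>
    define t where "t = - (\<Sum>s\<in>C - {p}. c s * A r s) / A r p"
    have split: "(\<Sum>s\<in>C. (c(p := t)) s * A q s) = t * A q p + (\<Sum>s\<in>C - {p}. c s * A q s)" for q
      using p insert.prems by (simp add: sum.remove[of C p])
    have "(\<Sum>s\<in>C. (c(p := t)) s * A q s) = 0" if "q \<in> insert r R" for q
    proof (cases "q = r")
      case True
      then show ?thesis using p by (simp only: split) (simp add: t_def)
    next
      case False
      with that c have "0 = (\<Sum>s\<in>C - {p}. c s * (A q s - A q p * A r s / A r p))" by simp
      also have "\<dots> = (\<Sum>s\<in>C - {p}. c s * A q s) - A q p / A r p * (\<Sum>s\<in>C - {p}. c s * A r s)"
        by (simp add: sum_distrib_left flip: sum_subtractf) (simp add: algebra_simps)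
      finally show ?thesis by (simp only: split) (simp add: t_def algebra_simps)
    qed
    then show ?thesis using nz by (intro exI[of _ "c(p := t)"]) auto
  qed
qed

text \<open>Adjoining \<open>b\<close> as an extra column makes the system wide.  Any dependence of the augmented
  columns involves \<open>b\<close>, since the others are independent, and so expresses \<open>b\<close> through them.\<close>

lemma independent_square_system_solvable:
  fixes A :: "'v \<Rightarrow> 'v \<Rightarrow> 'k::field"
  assumes "finite V" "\<not> dependent_columns V A V"
  shows "\<exists>x. \<forall>v\<in>V. (\<Sum>u\<in>V. A v u * x u) = b v"
proof -
  define C where "C = insert None (Some ` V)"
  have "card V < card C"
    using assms(1) by (simp add: C_def card_image card_insert_if)
  with wide_system_has_nonzero_solution[of V C "\<lambda>v s. case s of None \<Rightarrow> - b v | Some u \<Rightarrow> A v u"]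
  obtain c where nz: "\<exists>s\<in>C. c s \<noteq> 0"
    and c: "\<forall>v\<in>V. (\<Sum>s\<in>C. c s * (case s of None \<Rightarrow> - b v | Some u \<Rightarrow> A v u)) = 0"
    using assms(1) unfolding C_def by auto
  have eq: "(\<Sum>u\<in>V. c (Some u) * A v u) = c None * b v" if "v \<in> V" for v
    using c that assms(1) by (auto simp: C_def sum.reindex algebra_simps)
  have None: "c None \<noteq> 0"
  proof
    assume "c None = 0"
    with eq nz have "dependent_columns V A V"
      unfolding dependent_columns_def C_def by (intro exI[of _ "\<lambda>u. c (Some u)"]) auto
    with assms show False by simp
  qed
  have "(\<Sum>u\<in>V. A v u * (c (Some u) / c None)) = b v" if "v \<in> V" for v
  proof -
    have "(\<Sum>u\<in>V. A v u * (c (Some u) / c None)) = (\<Sum>u\<in>V. c (Some u) * A v u) / c None"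
      by (simp add: sum_divide_distrib mult.commute)
    with eq[OF that] None show ?thesis by simp
  qed
  then show ?thesis by (intro exI[of _ "\<lambda>u. c (Some u) / c None"]) simp
qed

lemma nonsingular_on_iff_independent_columns:
  fixes A :: "'v \<Rightarrow> 'v \<Rightarrow> 'k::field"
  assumes "finite V"
  shows "nonsingular_on V A \<longleftrightarrow> \<not> dependent_columns V A V"
proof
  assume "nonsingular_on V A"
  then obtain B where B: "\<forall>v\<in>V. \<forall>w\<in>V. (\<Sum>u\<in>V. B v u * A u w) = (if v = w then 1 else 0)"
    unfolding nonsingular_on_def by blast
  show "\<not> dependent_columns V A V"
  proof
    assume "dependent_columns V A V"
    then obtain c where nz: "\<exists>s\<in>V. c s \<noteq> 0" and c: "\<forall>v\<in>V. (\<Sum>s\<in>V. c s * A v s) = 0"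
      unfolding dependent_columns_def by blast
    have "c v = 0" if "v \<in> V" for v
    proof -
      have "c v = (\<Sum>s\<in>V. (if v = s then 1 else 0) * c s)"
        using that assms by (simp add: if_distrib[of "\<lambda>x. x * _"] cong: if_cong)
      also have "\<dots> = (\<Sum>s\<in>V. (\<Sum>u\<in>V. B v u * A u s) * c s)"
        using B that by simp
      also have "\<dots> = (\<Sum>s\<in>V. \<Sum>u\<in>V. B v u * (c s * A u s))"
        by (simp add: sum_distrib_left sum_distrib_right mult_ac)
      also have "\<dots> = (\<Sum>u\<in>V. B v u * (\<Sum>s\<in>V. c s * A u s))"
        by (subst sum.swap) (simp add: sum_distrib_left)
      finally show ?thesis using c by simp
    qed
    with nz show False by blast
  qed
next
  assume ind: "\<not> dependent_columns V A V"
  have "\<exists>x. \<forall>v\<in>V. (\<Sum>u\<in>V. A v u * x u) = (if v = w then 1 else 0)" for w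
    using independent_square_system_solvable[OF assms ind] .
  then obtain X where X: "\<And>w. \<forall>v\<in>V. (\<Sum>u\<in>V. A v u * X w u) = (if v = w then 1 else 0)"
    by metis
  \<comment> \<open>The transpose of \<open>X\<close> is a right inverse \<open>B\<close>, and \<open>A (B A - 1) = 0\<close> makes it a left inverse,
    because \<open>A\<close> has trivial kernel.\<close>
  define d where "d w v = (\<Sum>u\<in>V. X u v * A u w) - (if v = w then 1 else 0)" for w v
  have "d w v = 0" if "v \<in> V" "w \<in> V" for v w
  proof -
    have "(\<Sum>s\<in>V. d w s * A q s) = 0" if q: "q \<in> V" for q
    proof -
      have "(\<Sum>s\<in>V. d w s * A q s) =
          (\<Sum>s\<in>V. \<Sum>u\<in>V. A u w * (A q s * X u s)) - (\<Sum>s\<in>V. (if s = w then 1 else 0) * A q s)"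
        by (simp only: d_def left_diff_distrib sum_subtractf)
          (simp add: sum_distrib_left sum_distrib_right mult_ac)
      also have "(\<Sum>s\<in>V. \<Sum>u\<in>V. A u w * (A q s * X u s)) = (\<Sum>u\<in>V. A u w * (\<Sum>s\<in>V. A q s * X u s))"
        by (subst sum.swap) (simp add: sum_distrib_left)
      also have "\<dots> = (\<Sum>u\<in>V. if q = u then A u w else 0)"
        using X q by (intro sum.cong) auto
      also have "\<dots> = A q w" using assms q by simp
      also have "(\<Sum>s\<in>V. (if s = w then 1 else 0) * A q s) = A q w"
        using assms \<open>w \<in> V\<close> by (simp add: if_distrib[of "\<lambda>x. x * _"] cong: if_cong)
      finally show ?thesis by simp
    qed
    then show ?thesis using ind \<open>v \<in> V\<close> unfolding dependent_columns_def by blast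
  qed
  then have "\<forall>v\<in>V. \<forall>w\<in>V. (\<Sum>u\<in>V. X u v * A u w) = (if v = w then 1 else 0)"
    unfolding d_def by simp
  with X show "nonsingular_on V A"
    unfolding nonsingular_on_def by (intro exI[of _ "\<lambda>u w. X w u"]) simp
qed

section \<open>The matroid of the columns of a matrix\<close>

lemma dependent_columns_mono:
  assumes "dependent_columns V A I" "I \<subseteq> J" "finite J"
  shows "dependent_columns V A J"
proof -
  obtain c where c: "\<exists>s\<in>I. c s \<noteq> 0" "\<forall>v\<in>V. (\<Sum>s\<in>I. c s * A v s) = 0"
    using assms(1) unfolding dependent_columns_def by blast
  have "(\<Sum>s\<in>J. (if s \<in> I then c s else 0) * A v s) = (\<Sum>s\<in>I. c s * A v s)" for v
    using assms by (intro sum.mono_neutral_cong_right) auto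
  with c assms(2) show ?thesis
    unfolding dependent_columns_def by (intro exI[of _ "\<lambda>s. if s \<in> I then c s else 0"]) auto
qed

lemma dependent_columns_fewer_rows:
  assumes "dependent_columns W A I" "V \<subseteq> W"
  shows "dependent_columns V A I"
proof -
  obtain c where "\<exists>s\<in>I. c s \<noteq> 0" "\<forall>v\<in>W. (\<Sum>s\<in>I. c s * A v s) = 0"
    using assms(1) unfolding dependent_columns_def by blast
  with assms(2) show ?thesis
    unfolding dependent_columns_def by (intro exI[of _ c]) auto
qed

lemma dependent_columns_cong:
  assumes "\<And>v s. v \<in> V \<Longrightarrow> s \<in> S \<Longrightarrow> A v s = B v s"
  shows "dependent_columns V A S \<longleftrightarrow> dependent_columns V B S"
proof -
  have "(\<Sum>s\<in>S. c s * A v s) = (\<Sum>s\<in>S. c s * B v s)" if "v \<in> V" for c v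
    using assms that by (intro sum.cong) auto
  then show ?thesis unfolding dependent_columns_def by simp
qed

definition column_matroid :: "'v set \<Rightarrow> ('v \<Rightarrow> 'v \<Rightarrow> 'k::field) \<Rightarrow> 'v matroid" where
  "column_matroid V A =
     \<lparr>ground = V, circuits = minimal_sets {S. S \<noteq> {} \<and> S \<subseteq> V \<and> dependent_columns V A S}\<rparr>"

lemma column_matroid_circuit_iff:
  "C \<in> circuits (column_matroid V A) \<longleftrightarrow>
    C \<subseteq> V \<and> dependent_columns V A C \<and> (\<forall>S\<subseteq>C. dependent_columns V A S \<longrightarrow> S = C)"
proof -
  let ?F = "{S. S \<noteq> {} \<and> S \<subseteq> V \<and> dependent_columns V A S}"
  have nonempty: "S \<noteq> {}" if "dependent_columns V A S" for S
    using that by (auto simp: dependent_columns_def)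
  then have "C \<in> ?F \<longleftrightarrow> C \<subseteq> V \<and> dependent_columns V A C" by auto
  moreover have "(\<forall>S\<in>?F. S \<subseteq> C \<longrightarrow> S = C) \<longleftrightarrow> (\<forall>S\<subseteq>C. dependent_columns V A S \<longrightarrow> S = C)"
    if "C \<subseteq> V"
  proof -
    have "S \<in> ?F \<longleftrightarrow> dependent_columns V A S" if "S \<subseteq> C" for S
      using nonempty[of S] that \<open>C \<subseteq> V\<close> by auto
    then show ?thesis by (metis (no_types, lifting))
  qed
  ultimately show ?thesis
    unfolding column_matroid_def minimal_sets_def by auto
qed

lemma dependent_columns_contains_circuit:
  assumes "finite V" "S \<subseteq> V" "dependent_columns V A S"
  shows "\<exists>C\<in>circuits (column_matroid V A). C \<subseteq> S"
proof -
  let ?F = "{C. C \<subseteq> V \<and> dependent_columns V A C}"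
  have "finite ?F" "S \<in> ?F" using assms by simp_all
  then obtain C where C: "C \<subseteq> V" "dependent_columns V A C" "C \<subseteq> S"
    and min: "\<forall>D\<in>?F. D \<subseteq> C \<longrightarrow> C = D"
    using finite_has_minimal2[of ?F S] by auto
  have "D = C" if "D \<subseteq> C" "dependent_columns V A D" for D
  proof -
    have "D \<in> ?F" using that C(1) by simp
    with min that show ?thesis by blast
  qed
  with C show ?thesis unfolding Bex_def column_matroid_circuit_iff by blast
qed

lemma indep_sets_column_matroid:
  assumes "finite V"
  shows "indep_sets (column_matroid V A) = {I. I \<subseteq> V \<and> \<not> dependent_columns V A I}"
proof -
  have "(\<exists>C\<in>circuits (column_matroid V A). C \<subseteq> I) \<longleftrightarrow> dependent_columns V A I" if "I \<subseteq> V" for I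
  proof
    assume "\<exists>C\<in>circuits (column_matroid V A). C \<subseteq> I"
    then obtain C where "dependent_columns V A C" "C \<subseteq> I"
      by (auto simp: column_matroid_circuit_iff)
    then show "dependent_columns V A I"
      using finite_subset[OF that assms] by (rule dependent_columns_mono)
  qed (rule dependent_columns_contains_circuit[OF assms that])
  moreover have "ground (column_matroid V A) = V" by (simp add: column_matroid_def)
  ultimately show ?thesis unfolding indep_sets_def by (simp cong: conj_cong)
qed

text \<open>The support of a nontrivial dependence among the columns of a circuit is itself dependent,
  and by minimality it is the whole circuit.\<close>

lemma circuit_coefficients_nonzero:
  assumes "finite V" "C \<in> circuits (column_matroid V A)"
  shows "\<exists>c. (\<forall>s\<in>C. c s \<noteq> 0) \<and> (\<forall>v\<in>V. (\<Sum>s\<in>C. c s * A v s) = 0)"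
proof -
  have C: "C \<subseteq> V" "dependent_columns V A C"
    and min: "\<And>S. S \<subseteq> C \<Longrightarrow> dependent_columns V A S \<Longrightarrow> S = C"
    using assms(2) unfolding column_matroid_circuit_iff by blast+
  have fin: "finite C" using C assms finite_subset by blast
  obtain c where c: "\<exists>s\<in>C. c s \<noteq> 0" "\<forall>v\<in>V. (\<Sum>s\<in>C. c s * A v s) = 0"
    using C unfolding dependent_columns_def by blast
  have "(\<Sum>s\<in>{s\<in>C. c s \<noteq> 0}. c s * A v s) = (\<Sum>s\<in>C. c s * A v s)" for v
    using fin by (intro sum.mono_neutral_left) auto
  with c have "dependent_columns V A {s\<in>C. c s \<noteq> 0}"
    unfolding dependent_columns_def by (intro exI[of _ c]) auto
  with min[of "{s\<in>C. c s \<noteq> 0}"] have "{s\<in>C. c s \<noteq> 0} = C" by blast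
  with c show ?thesis by blast
qed

text \<open>Circuit elimination: given dependences \<open>c\<close> on \<open>C\<close> and \<open>d\<close> on \<open>D\<close> with no zero
  coefficients, the combination \<open>d\<^sub>x c - c\<^sub>x d\<close> vanishes at \<open>x\<close> but not on \<open>C - D\<close>.\<close>

lemma is_matroid_column_matroid:
  assumes "finite V"
  shows "is_matroid (column_matroid V A)"
proof -
  let ?M = "column_matroid V A"
  have elim: "\<exists>E\<in>circuits ?M. E \<subseteq> (C \<union> D) - {x}"
    if C: "C \<in> circuits ?M" and D: "D \<in> circuits ?M" and x: "x \<in> C \<inter> D" and ne: "C \<noteq> D" for C D x
  proof -
    have sub: "C \<subseteq> V" "D \<subseteq> V" "\<not> C \<subseteq> D"
      using C D ne unfolding column_matroid_circuit_iff by blast+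
    then have fin: "finite (C \<union> D)" using assms finite_subset by blast
    obtain c where c: "\<forall>s\<in>C. c s \<noteq> 0" "\<forall>v\<in>V. (\<Sum>s\<in>C. c s * A v s) = 0"
      using circuit_coefficients_nonzero[OF assms C] by blast
    obtain d where d: "\<forall>s\<in>D. d s \<noteq> 0" "\<forall>v\<in>V. (\<Sum>s\<in>D. d s * A v s) = 0"
      using circuit_coefficients_nonzero[OF assms D] by blast
    define e where "e s = d x * (if s \<in> C then c s else 0) - c x * (if s \<in> D then d s else 0)" for s
    obtain y where y: "y \<in> C" "y \<notin> D" using sub by blast
    have "e y \<noteq> 0" "y \<noteq> x" using y x c d by (auto simp: e_def)
    moreover have "(\<Sum>s\<in>C \<union> D - {x}. e s * A v s) = 0" if v: "v \<in> V" for v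
    proof -
      have "(\<Sum>s\<in>C \<union> D - {x}. e s * A v s) = (\<Sum>s\<in>C \<union> D. e s * A v s)"
        using fin x by (intro sum.mono_neutral_left) (auto simp: e_def)
      also have "\<dots> = d x * (\<Sum>s\<in>C \<union> D. (if s \<in> C then c s else 0) * A v s)
          - c x * (\<Sum>s\<in>C \<union> D. (if s \<in> D then d s else 0) * A v s)"
        by (simp only: e_def left_diff_distrib sum_subtractf sum_distrib_left mult.assoc)
      also have "(\<Sum>s\<in>C \<union> D. (if s \<in> C then c s else 0) * A v s) = (\<Sum>s\<in>C. c s * A v s)"
        using fin by (intro sum.mono_neutral_cong_right) auto
      also have "(\<Sum>s\<in>C \<union> D. (if s \<in> D then d s else 0) * A v s) = (\<Sum>s\<in>D. d s * A v s)"
        using fin by (intro sum.mono_neutral_cong_right) auto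
      finally show ?thesis using c d v by simp
    qed
    ultimately have "dependent_columns V A (C \<union> D - {x})"
      using y unfolding dependent_columns_def by (intro exI[of _ e]) auto
    then show ?thesis
      using dependent_columns_contains_circuit[OF assms] sub by (meson Diff_subset Un_least order_trans)
  qed
  have "finite (ground ?M)" "circuits ?M \<subseteq> Pow (ground ?M)" "{} \<notin> circuits ?M"
    "\<forall>C\<in>circuits ?M. \<forall>D\<in>circuits ?M. C \<subseteq> D \<longrightarrow> C = D"
    using assms by (auto simp: column_matroid_def minimal_sets_def)
  with elim show ?thesis unfolding is_matroid_def by blast
qed

section \<open>Principal submatrices of symmetric matrices\<close>

text \<open>This is where the symmetry of \<open>A\<close> links column rank to principal submatrices: maximality makes
  every column, hence every row, of \<open>A[S]\<close> a combination of those indexed by \<open>B\<close>.\<close>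

lemma maximal_independent_columns_principal:
  fixes A :: "'v \<Rightarrow> 'v \<Rightarrow> 'k::field"
  assumes "finite S" "B \<subseteq> S" and sym: "\<And>v w. A v w = A w v"
    and ind: "\<not> dependent_columns S A B"
    and max: "\<And>v. v \<in> S - B \<Longrightarrow> dependent_columns S A (insert v B)"
  shows "\<not> dependent_columns B A B"
proof
  have fin: "finite B" using assms finite_subset by blast
  assume "dependent_columns B A B"
  then obtain c where nz: "\<exists>s\<in>B. c s \<noteq> 0" and c: "\<forall>v\<in>B. (\<Sum>s\<in>B. c s * A v s) = 0"
    unfolding dependent_columns_def by blast
  have "(\<Sum>s\<in>B. c s * A v s) = 0" if v: "v \<in> S" for v
  proof (cases "v \<in> B")
    case False
    obtain d where d_nz: "\<exists>s\<in>insert v B. d s \<noteq> 0"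
      and d: "\<forall>w\<in>S. (\<Sum>s\<in>insert v B. d s * A w s) = 0"
      using max[of v] v False unfolding dependent_columns_def by blast
    have d': "d v * A w v = - (\<Sum>s\<in>B. d s * A w s)" if "w \<in> S" for w
      using d that fin False by (simp add: eq_neg_iff_add_eq_0)
    have dv: "d v \<noteq> 0"
    proof
      assume "d v = 0"
      then have "dependent_columns S A B"
        using d_nz d fin False unfolding dependent_columns_def by (intro exI[of _ d]) auto
      with ind show False by simp
    qed
    \<comment> \<open>By symmetry the row \<open>v\<close> is a combination of the rows in \<open>B\<close>, and these annihilate \<open>c\<close>.\<close>
    have "d v * (\<Sum>s\<in>B. c s * A v s) = (\<Sum>s\<in>B. c s * (d v * A s v))"
      by (simp add: sum_distrib_left mult_ac) (simp add: sym[of v])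
    also have "\<dots> = (\<Sum>s\<in>B. c s * - (\<Sum>t\<in>B. d t * A s t))"
      using d' assms(2) by (intro sum.cong) auto
    also have "\<dots> = - (\<Sum>s\<in>B. \<Sum>t\<in>B. d t * (c s * A t s))"
      by (simp add: sum_distrib_left sum_negf mult.left_commute sym)
    also have "(\<Sum>s\<in>B. \<Sum>t\<in>B. d t * (c s * A t s)) = (\<Sum>t\<in>B. d t * (\<Sum>s\<in>B. c s * A t s))"
      by (subst sum.swap) (simp add: sum_distrib_left)
    finally show ?thesis using c dv by simp
  qed (use c in simp)
  with nz ind show False unfolding dependent_columns_def by blast
qed

lemma independent_columns_extend_to_principal:
  fixes A :: "'v \<Rightarrow> 'v \<Rightarrow> 'k::field"
  assumes "finite S" "I \<subseteq> S" and sym: "\<And>v w. A v w = A w v"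
    and "\<not> dependent_columns S A I"
  shows "\<exists>X. I \<subseteq> X \<and> X \<subseteq> S \<and> \<not> dependent_columns X A X"
proof -
  let ?F = "{X. X \<subseteq> S \<and> \<not> dependent_columns S A X}"
  have "finite ?F" "I \<in> ?F" using assms by auto
  then obtain X where X: "X \<subseteq> S" "\<not> dependent_columns S A X" "I \<subseteq> X"
    and max: "\<forall>Y\<in>?F. X \<subseteq> Y \<longrightarrow> X = Y"
    using finite_has_maximal2[of ?F I] by auto
  have "dependent_columns S A (insert v X)" if "v \<in> S - X" for v
  proof (rule ccontr)
    assume "\<not> dependent_columns S A (insert v X)"
    then have "insert v X \<in> ?F" using that X by auto
    with max have "X = insert v X" by blast
    with that show False by blast
  qed
  with X maximal_independent_columns_principal[OF assms(1) X(1) sym X(2)] show ?thesis by blast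
qed

lemma principal_imp_independent_columns:
  assumes "\<not> dependent_columns X A X" "I \<subseteq> X" "X \<subseteq> S" "finite X"
  shows "\<not> dependent_columns S A I"
proof
  assume "dependent_columns S A I"
  then have "dependent_columns S A X" using assms(2,4) by (rule dependent_columns_mono)
  then have "dependent_columns X A X" using assms(3) by (rule dependent_columns_fewer_rows)
  with assms(1) show False ..
qed

lemma independent_columns_iff_subset_of_principal:
  fixes A :: "'v \<Rightarrow> 'v \<Rightarrow> 'k::field"
  assumes "finite S" and sym: "\<And>v w. A v w = A w v"
  shows "I \<subseteq> S \<and> \<not> dependent_columns S A I \<longleftrightarrow>
    (\<exists>X\<in>{X. X \<subseteq> S \<and> \<not> dependent_columns X A X}. I \<subseteq> X)"
proof
  assume I: "I \<subseteq> S \<and> \<not> dependent_columns S A I"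
  obtain X where "I \<subseteq> X" "X \<subseteq> S" "\<not> dependent_columns X A X"
    using independent_columns_extend_to_principal[OF assms(1) conjunct1[OF I] sym conjunct2[OF I]]
    by auto
  then show "\<exists>X\<in>{X. X \<subseteq> S \<and> \<not> dependent_columns X A X}. I \<subseteq> X"
    by (intro bexI[of _ X]) simp_all
next
  assume "\<exists>X\<in>{X. X \<subseteq> S \<and> \<not> dependent_columns X A X}. I \<subseteq> X"
  then obtain X where X: "\<not> dependent_columns X A X" "I \<subseteq> X" "X \<subseteq> S" by auto
  then have "\<not> dependent_columns S A I"
    using finite_subset[OF X(3) assms(1)] by (rule principal_imp_independent_columns)
  moreover have "I \<subseteq> S" using X(2,3) by (rule order_trans)
  ultimately show "I \<subseteq> S \<and> \<not> dependent_columns S A I" by simp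
qed

text \<open>Turns a description of the independent sets as subsets of members of a family into one of the
  bases as maximal members.\<close>

lemma maximal_sets_down_closure:
  "maximal_sets {I. \<exists>X\<in>P. I \<subseteq> X} = maximal_sets P"
proof (intro set_eqI iffI)
  fix B assume "B \<in> maximal_sets {I. \<exists>X\<in>P. I \<subseteq> X}"
  then obtain X where X: "X \<in> P" "B \<subseteq> X" and max: "\<And>Y. Y \<in> P \<Longrightarrow> B \<subseteq> Y \<Longrightarrow> Y = B"
    by (auto simp: maximal_sets_def)
  have "X = B" using X by (rule max)
  with X max show "B \<in> maximal_sets P" by (simp add: maximal_sets_def)
next
  fix B assume B: "B \<in> maximal_sets P"
  have "Y = B" if "B \<subseteq> Y" "Y \<subseteq> X" "X \<in> P" for X Y
  proof -
    have "X = B" using B that by (simp add: maximal_sets_def)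
    with that show ?thesis by simp
  qed
  with B show "B \<in> maximal_sets {I. \<exists>X\<in>P. I \<subseteq> X}"
    unfolding maximal_sets_def by (simp, blast)
qed

section \<open>Symmetric exchange for principal submatrices\<close>

definition mat_vec :: "'v set \<Rightarrow> ('v \<Rightarrow> 'v \<Rightarrow> 'k::field) \<Rightarrow> ('v \<Rightarrow> 'k) \<Rightarrow> 'v \<Rightarrow> 'k" where
  "mat_vec V A x v = (\<Sum>u\<in>V. A v u * x u)"

text \<open>Half of the coordinates of \<open>(x, A x)\<close>, selected by \<open>X\<close>; \<open>pivot_output\<close> is the other half.
  When \<open>A[X]\<close> is nonsingular, the map from inputs to outputs is, up to signs, the principal pivot
  transform of \<open>A\<close> on \<open>X\<close>.  Treating both halves as functions of \<open>x\<close> makes them available for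
  singular \<open>A[X]\<close> too.\<close>

definition pivot_input :: "'v set \<Rightarrow> ('v \<Rightarrow> 'v \<Rightarrow> 'k::field) \<Rightarrow> 'v set \<Rightarrow> ('v \<Rightarrow> 'k) \<Rightarrow> 'v \<Rightarrow> 'k" where
  "pivot_input V A X x v = (if v \<in> X then mat_vec V A x v else x v)"

definition pivot_output :: "'v set \<Rightarrow> ('v \<Rightarrow> 'v \<Rightarrow> 'k::field) \<Rightarrow> 'v set \<Rightarrow> ('v \<Rightarrow> 'k) \<Rightarrow> 'v \<Rightarrow> 'k" where
  "pivot_output V A X x v = (if v \<in> X then x v else mat_vec V A x v)"

lemma mat_vec_lincomb:
  "mat_vec V A (\<lambda>s. x s - a * y s) v = mat_vec V A x v - a * mat_vec V A y v"
  by (simp add: mat_vec_def right_diff_distrib sum_subtractf sum_distrib_left mult_ac)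

lemma mat_vec_self_adjoint:
  assumes "\<And>v w. A v w = A w v"
  shows "(\<Sum>v\<in>V. x v * mat_vec V A y v) = (\<Sum>v\<in>V. y v * mat_vec V A x v)"
proof -
  have "(\<Sum>v\<in>V. x v * mat_vec V A y v) = (\<Sum>u\<in>V. \<Sum>v\<in>V. x v * (A v u * y u))"
    by (simp add: mat_vec_def sum_distrib_left) (subst sum.swap, simp)
  also have "\<dots> = (\<Sum>u\<in>V. y u * mat_vec V A x u)"
    by (simp add: mat_vec_def sum_distrib_left mult_ac assms)
  finally show ?thesis .
qed

text \<open>The standard symplectic form \<open>\<Sum>\<^sub>v (p\<^sub>v (A q)\<^sub>v - q\<^sub>v (A p)\<^sub>v)\<close> vanishes on the graph of a symmetric
  matrix; swapping the two coordinates at \<open>v \<notin> X\<close> changes the sign of the corresponding term.\<close>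

lemma pivot_isotropic:
  assumes "\<And>v w. A v w = A w v"
  shows "(\<Sum>v\<in>V. (if v \<in> X then 1 else - 1) *
    (pivot_output V A X p v * pivot_input V A X q v - pivot_input V A X p v * pivot_output V A X q v)) = 0"
proof -
  have "(if v \<in> X then 1 else - 1) *
      (pivot_output V A X p v * pivot_input V A X q v - pivot_input V A X p v * pivot_output V A X q v) =
      p v * mat_vec V A q v - q v * mat_vec V A p v" for v
    by (simp add: pivot_input_def pivot_output_def algebra_simps)
  then show ?thesis
    using mat_vec_self_adjoint[of A p V q] assms by (simp add: sum_subtractf)
qed

text \<open>Zero input means that \<open>x\<close> is supported on \<open>X\<close> and \<open>A x\<close> vanishes there, so the input map is
  injective on vectors over \<open>V\<close> exactly when \<open>A[X]\<close> has trivial kernel.\<close>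

lemma principal_iff_pivot_input_injective:
  assumes "finite V" "X \<subseteq> V"
  shows "\<not> dependent_columns X A X \<longleftrightarrow>
    (\<forall>x. (\<forall>v\<in>V. pivot_input V A X x v = 0) \<longrightarrow> (\<forall>v\<in>V. x v = 0))"
proof -
  have eq: "mat_vec V A x v = (\<Sum>s\<in>X. x s * A v s)" if "\<forall>s\<in>V - X. x s = 0" for x v
    unfolding mat_vec_def using assms that
    by (intro sum.mono_neutral_cong_right) (auto simp: mult.commute)
  show ?thesis
  proof (intro iffI allI impI)
    fix x assume ind: "\<not> dependent_columns X A X" and x: "\<forall>v\<in>V. pivot_input V A X x v = 0"
    then have out: "\<forall>s\<in>V - X. x s = 0" by (auto simp: pivot_input_def)
    have "(\<Sum>s\<in>X. x s * A v s) = 0" if "v \<in> X" for v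
    proof -
      have "v \<in> V" using that assms(2) by blast
      with x have "pivot_input V A X x v = 0" by blast
      with that eq[OF out, of v] show ?thesis by (simp add: pivot_input_def)
    qed
    with ind have "\<forall>s\<in>X. x s = 0" unfolding dependent_columns_def by blast
    with out show "\<forall>v\<in>V. x v = 0" by blast
  next
    assume inj: "\<forall>x. (\<forall>v\<in>V. pivot_input V A X x v = 0) \<longrightarrow> (\<forall>v\<in>V. x v = 0)"
    show "\<not> dependent_columns X A X"
    proof
      assume "dependent_columns X A X"
      then obtain c where nz: "\<exists>s\<in>X. c s \<noteq> 0" and c: "\<forall>v\<in>X. (\<Sum>s\<in>X. c s * A v s) = 0"
        unfolding dependent_columns_def by blast
      let ?x = "\<lambda>s. if s \<in> X then c s else 0"
      have "mat_vec V A ?x v = (\<Sum>s\<in>X. c s * A v s)" for v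
        using eq[of ?x v] by simp
      with c have "\<forall>v\<in>V. pivot_input V A X ?x v = 0" by (simp add: pivot_input_def)
      with inj have "\<forall>v\<in>V. ?x v = 0" by blast
      with nz assms(2) show False by (force split: if_splits)
    qed
  qed
qed

lemma principal_imp_pivot_input_surjective:
  assumes "finite V" "X \<subseteq> V" "\<not> dependent_columns X A X"
  shows "\<exists>x. \<forall>v\<in>V. pivot_input V A X x v = b v"
proof -
  have fin: "finite X" using assms finite_subset by blast
  obtain x where x: "\<forall>v\<in>X. (\<Sum>u\<in>X. A v u * x u) = b v - (\<Sum>u\<in>V - X. A v u * b u)"
    using independent_square_system_solvable[OF fin assms(3),
        of "\<lambda>v. b v - (\<Sum>u\<in>V - X. A v u * b u)"] by blast
  have "mat_vec V A (\<lambda>s. if s \<in> X then x s else b s) v =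
      (\<Sum>u\<in>V - X. A v u * b u) + (\<Sum>u\<in>X. A v u * x u)" for v
    unfolding mat_vec_def using assms by (simp add: sum.subset_diff[of X V])
  with x show ?thesis
    by (intro exI[of _ "\<lambda>s. if s \<in> X then x s else b s"]) (auto simp: pivot_input_def)
qed

text \<open>Let \<open>p\<close> be the vector whose input with respect to \<open>X\<close> is the unit vector at \<open>u\<close>.  If its output
  at \<open>u\<close> is nonzero, then \<open>u\<close> can be exchanged alone.  Otherwise, since the input of \<open>p\<close> with
  respect to \<open>Y\<close> is nonzero and differs from the one for \<open>X\<close> only on the symmetric difference,
  \<open>p\<close> has a nonzero output at some \<open>v \<noteq> u\<close> there, and \<open>u\<close> and \<open>v\<close> can be exchanged together.
  In the language of the pivoted matrix, the last step inverts a symmetric (up to signs)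
  \<open>2 \<times> 2\<close> block with a zero diagonal entry and nonzero off-diagonal entries.\<close>

lemma principal_symmetric_exchange:
  fixes A :: "'v \<Rightarrow> 'v \<Rightarrow> 'k::field"
  assumes fin: "finite V" and sub: "X \<subseteq> V" "Y \<subseteq> V" and sym: "\<And>v w. A v w = A w v"
    and X: "\<not> dependent_columns X A X" and Y: "\<not> dependent_columns Y A Y"
    and u: "u \<in> sym_diff X Y"
  shows "\<not> dependent_columns (sym_diff X {u}) A (sym_diff X {u}) \<or>
    (\<exists>v\<in>sym_diff X Y. v \<noteq> u \<and> \<not> dependent_columns (sym_diff X {u, v}) A (sym_diff X {u, v}))"
proof -
  have uV: "u \<in> V" using u sub by auto
  obtain p where p: "\<forall>v\<in>V. pivot_input V A X p v = (if v = u then 1 else 0)"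
    using principal_imp_pivot_input_surjective[OF fin sub(1) X, of "\<lambda>v. if v = u then 1 else 0"] by blast
  have injective: "\<forall>v\<in>V. x v = 0"
    if "\<not> dependent_columns Z A Z" "Z \<subseteq> V" "\<forall>v\<in>V. pivot_input V A Z x v = 0" for Z x
    using iffD1[OF principal_iff_pivot_input_injective[OF fin that(2)] that(1)] that(3) by simp
  \<comment> \<open>Such \<open>q\<close> and \<open>a p\<close>, with \<open>a\<close> the input of \<open>q\<close> at \<open>u\<close>, have the same input.\<close>
  have multiple: "\<exists>a. \<forall>s\<in>V. q s = a * p s \<and> mat_vec V A q s = a * mat_vec V A p s"
    if q: "\<forall>s\<in>V - {u}. pivot_input V A X q s = 0" for q
  proof -
    let ?a = "pivot_input V A X q u"
    let ?r = "\<lambda>s. q s - ?a * p s"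
    have "pivot_input V A X ?r s = pivot_input V A X q s - ?a * pivot_input V A X p s" for s
      by (simp add: pivot_input_def mat_vec_lincomb)
    then have "\<forall>s\<in>V. pivot_input V A X ?r s = 0" using p q by auto
    then have r: "\<forall>s\<in>V. ?r s = 0"
      using injective[OF X sub(1)] by blast
    then have "mat_vec V A ?r s = 0" for s by (simp add: mat_vec_def)
    with r show ?thesis by (intro exI[of _ ?a]) (auto simp: mat_vec_lincomb)
  qed
  show ?thesis
  proof (cases "pivot_output V A X p u = 0")
    case False
    have "\<forall>s\<in>V. q s = 0" if q: "\<forall>s\<in>V. pivot_input V A (sym_diff X {u}) q s = 0" for q
    proof -
      have "\<forall>s\<in>V - {u}. pivot_input V A X q s = 0"
        using q by (auto simp: pivot_input_def split: if_splits)
      then obtain a where a: "\<forall>s\<in>V. q s = a * p s \<and> mat_vec V A q s = a * mat_vec V A p s"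
        using multiple by blast
      have "a * pivot_output V A X p u = 0"
        using q[rule_format, OF uV] a uV by (auto simp: pivot_input_def pivot_output_def split: if_splits)
      with False have "a = 0" by simp
      with a show ?thesis by simp
    qed
    moreover have "sym_diff X {u} \<subseteq> V" using sub uV by auto
    ultimately have "\<not> dependent_columns (sym_diff X {u}) A (sym_diff X {u})"
      using principal_iff_pivot_input_injective[OF fin, of "sym_diff X {u}" A] by simp
    then show ?thesis ..
  next
    case True
    have "\<exists>s\<in>V. p s \<noteq> 0"
    proof (rule ccontr)
      assume "\<not> ?thesis"
      then have "pivot_input V A X p u = 0"
        using uV by (simp add: pivot_input_def mat_vec_def)
      with p uV show False by simp
    qed
    then obtain v where v: "v \<in> V" "pivot_input V A Y p v \<noteq> 0"
      using injective[OF Y sub(2)] by blast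
    have vd: "v \<in> sym_diff X Y" "v \<noteq> u" "pivot_output V A X p v \<noteq> 0"
      using v p True u by (auto simp: pivot_input_def pivot_output_def split: if_splits)
    have "\<forall>s\<in>V. q s = 0" if q: "\<forall>s\<in>V. pivot_input V A (sym_diff X {u, v}) q s = 0" for q
    proof -
      have other: "pivot_input V A X q s = 0" if "s \<in> V" "s \<noteq> u" "s \<noteq> v" for s
        using q that by (auto simp: pivot_input_def split: if_splits)
      have out: "pivot_output V A X q u = 0" "pivot_output V A X q v = 0"
        using q[rule_format, OF uV] q[rule_format, OF v(1)]
        by (auto simp: pivot_input_def pivot_output_def split: if_splits)
      let ?t = "\<lambda>s. (if s \<in> X then 1 else - 1) *
        (pivot_output V A X p s * pivot_input V A X q s - pivot_input V A X p s * pivot_output V A X q s)"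
      \<comment> \<open>Pairing \<open>p\<close> with \<open>q\<close> leaves only the term at \<open>v\<close>, which forces the input of \<open>q\<close>
        there to vanish.\<close>
      have "0 = (\<Sum>s\<in>V. ?t s)"
        using pivot_isotropic[OF sym] by simp
      also have "\<dots> = (\<Sum>s\<in>{v}. ?t s)"
      proof (intro sum.mono_neutral_right ballI)
        fix s assume "s \<in> V - {v}"
        then show "?t s = 0"
          using p other[of s] out True by (cases "s = u") auto
      qed (use fin v in auto)
      also have "\<dots> = (if v \<in> X then 1 else - 1) * (pivot_output V A X p v * pivot_input V A X q v)"
        using p v vd by simp
      finally have "pivot_input V A X q v = 0" using vd by (auto split: if_splits)
      with other have "\<forall>s\<in>V - {u}. pivot_input V A X q s = 0" by auto
      then obtain a where a: "\<forall>s\<in>V. q s = a * p s \<and> mat_vec V A q s = a * mat_vec V A p s"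
        using multiple by blast
      have "a * pivot_output V A X p v = 0"
        using out(2) a v by (auto simp: pivot_output_def split: if_splits)
      with vd have "a = 0" by simp
      with a show ?thesis by simp
    qed
    moreover have "sym_diff X {u, v} \<subseteq> V" using sub uV v by auto
    ultimately have "\<not> dependent_columns (sym_diff X {u, v}) A (sym_diff X {u, v})"
      using principal_iff_pivot_input_injective[OF fin, of "sym_diff X {u, v}" A] by simp
    with vd show ?thesis by blast
  qed
qed

section \<open>Adjacency matrices\<close>

lemma adj_matrix_sym: "adj_matrix G v w = adj_matrix G w v"
  by (auto simp: adj_matrix_def adjacent_def insert_commute)

lemma adj_matrix_induced_subgraph:
  "v \<in> S \<Longrightarrow> w \<in> S \<Longrightarrow> adj_matrix (induced_subgraph G S) v w = adj_matrix G v w"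
proof -
  assume "v \<in> S" "w \<in> S"
  then have "looped (induced_subgraph G S) v = looped G v"
    "adjacent (induced_subgraph G S) v w = adjacent G v w"
    by (auto simp: looped_def adjacent_def induced_subgraph_def)
  then show ?thesis by (simp only: adj_matrix_def)
qed

lemma adjacency_matroid_induced_subgraph:
  "adjacency_matroid (induced_subgraph G S) = column_matroid S (adj_matrix G)"
proof -
  have "dependent_columns S (adj_matrix (induced_subgraph G S)) I \<longleftrightarrow> dependent_columns S (adj_matrix G) I"
    if "I \<subseteq> S" for I
    using that by (intro dependent_columns_cong adj_matrix_induced_subgraph) auto
  then have "{I. I \<noteq> {} \<and> I \<subseteq> S \<and> dependent_columns S (adj_matrix (induced_subgraph G S)) I} =
      {I. I \<noteq> {} \<and> I \<subseteq> S \<and> dependent_columns S (adj_matrix G) I}" by blast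
  then show ?thesis
    by (simp add: adjacency_matroid_def column_matroid_def) (simp add: induced_subgraph_def)
qed

lemma snd_graph_delta_matroid:
  assumes "finite (verts G)"
  shows "snd (graph_delta_matroid G) = {X. X \<subseteq> verts G \<and> \<not> dependent_columns X (adj_matrix G) X}"
proof -
  have "nonsingular_on X (adj_matrix (induced_subgraph G X)) \<longleftrightarrow> \<not> dependent_columns X (adj_matrix G) X"
    if "X \<subseteq> verts G" for X
  proof -
    have "dependent_columns X (adj_matrix (induced_subgraph G X)) X \<longleftrightarrow> dependent_columns X (adj_matrix G) X"
      by (intro dependent_columns_cong adj_matrix_induced_subgraph) auto
    with nonsingular_on_iff_independent_columns[OF finite_subset[OF that assms]] show ?thesis
      by blast
  qed
  then show ?thesis unfolding graph_delta_matroid_def by auto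
qed

lemma graph_delta_matroid_induced_subgraph:
  assumes "finite S"
  shows "graph_delta_matroid (induced_subgraph G S) =
    (S, {X. X \<subseteq> S \<and> \<not> dependent_columns X (adj_matrix G) X})"
proof -
  have "dependent_columns X (adj_matrix (induced_subgraph G S)) X \<longleftrightarrow> dependent_columns X (adj_matrix G) X"
    if "X \<subseteq> S" for X
    using that by (intro dependent_columns_cong adj_matrix_induced_subgraph) auto
  moreover have "verts (induced_subgraph G S) = S" by (simp add: induced_subgraph_def)
  ultimately have "snd (graph_delta_matroid (induced_subgraph G S)) =
      {X. X \<subseteq> S \<and> \<not> dependent_columns X (adj_matrix G) X}"
    using snd_graph_delta_matroid[of "induced_subgraph G S"] assms by auto
  moreover have "fst (graph_delta_matroid (induced_subgraph G S)) = S"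
    by (simp add: graph_delta_matroid_def induced_subgraph_def)
  ultimately show ?thesis by (metis prod.collapse)
qed

lemma is_delta_matroid_principal:
  fixes A :: "'v \<Rightarrow> 'v \<Rightarrow> 'k::field"
  assumes "finite S" and sym: "\<And>v w. A v w = A w v"
  shows "is_delta_matroid (S, {X. X \<subseteq> S \<and> \<not> dependent_columns X A X})"
proof -
  let ?D = "{X. X \<subseteq> S \<and> \<not> dependent_columns X A X}"
  have "{} \<in> ?D" by (simp add: dependent_columns_def)
  moreover have "sym_diff X {u} \<in> ?D \<or> (\<exists>v\<in>sym_diff X Y. v \<noteq> u \<and> sym_diff X {u, v} \<in> ?D)"
    if "X \<in> ?D" "Y \<in> ?D" and u: "u \<in> sym_diff X Y" for X Y u
  proof -
    have sub: "X \<subseteq> S" "Y \<subseteq> S" and ind: "\<not> dependent_columns X A X" "\<not> dependent_columns Y A Y"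
      using that by auto
    have "sym_diff X {u} \<subseteq> S" "\<And>v. v \<in> sym_diff X Y \<Longrightarrow> sym_diff X {u, v} \<subseteq> S"
      using sub u by auto
    with principal_symmetric_exchange[OF assms(1) sub sym ind u] show ?thesis by blast
  qed
  ultimately show ?thesis
    using assms(1) unfolding is_delta_matroid_def fst_conv snd_conv by blast
qed

theorem theorem27:
  fixes G :: "('v, 'e) multigraph" and S :: "'v set"
  assumes "fin_multigraph G" and "S \<subseteq> verts G"
  shows "(is_matroid (adjacency_matroid (induced_subgraph G S)) \<and>
          ground (adjacency_matroid (induced_subgraph G S)) = S \<and>
          bases (adjacency_matroid (induced_subgraph G S)) =
            maximal_sets {B. B \<subseteq> S \<and> B \<in> snd (graph_delta_matroid G)}) \<and>
         (is_matroid (adjacency_matroid (induced_subgraph G S)) \<and>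
          ground (adjacency_matroid (induced_subgraph G S)) = S \<and>
          indep_sets (adjacency_matroid (induced_subgraph G S)) =
            {I. I \<subseteq> S \<and> (\<exists>X \<in> snd (graph_delta_matroid G). I \<subseteq> X \<and> X \<subseteq> S)}) \<and>
         (is_delta_matroid (graph_delta_matroid (induced_subgraph G S)) \<and>
          graph_delta_matroid (induced_subgraph G S) =
            (S, \<Union>T\<in>Pow S. bases (adjacency_matroid (induced_subgraph G T))))"
proof -
  let ?A = "adj_matrix G"
  let ?M = "\<lambda>T. adjacency_matroid (induced_subgraph G T)"
  let ?P = "\<lambda>T. {X. X \<subseteq> T \<and> \<not> dependent_columns X ?A X}"
  have finG: "finite (verts G)" using assms(1) by (simp add: fin_multigraph_def)
  have fin: "finite S" using assms(2) finG finite_subset by blast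
  have D: "snd (graph_delta_matroid G) = ?P (verts G)"
    using finG by (rule snd_graph_delta_matroid)
  have indep: "indep_sets (?M T) = {I. \<exists>X\<in>?P T. I \<subseteq> X}" if "T \<subseteq> S" for T
  proof -
    have "finite T" using that fin finite_subset by blast
    then show ?thesis
      using independent_columns_iff_subset_of_principal[of T ?A, OF _ adj_matrix_sym]
      by (simp only: adjacency_matroid_induced_subgraph indep_sets_column_matroid)
  qed
  have bases: "bases (?M T) = maximal_sets (?P T)" if "T \<subseteq> S" for T
    unfolding bases_def using indep[OF that] by (simp only: maximal_sets_down_closure)
  have matroid: "is_matroid (?M S)" "ground (?M S) = S"
    using is_matroid_column_matroid[OF fin, of ?A]
    by (simp_all add: adjacency_matroid_induced_subgraph) (simp_all add: column_matroid_def)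
  have "{B. B \<subseteq> S \<and> B \<in> snd (graph_delta_matroid G)} = ?P S"
    using assms(2) by (auto simp: D)
  with bases[of S] have 1: "bases (?M S) = maximal_sets {B. B \<subseteq> S \<and> B \<in> snd (graph_delta_matroid G)}"
    by simp
  have 2: "indep_sets (?M S) = {I. I \<subseteq> S \<and> (\<exists>X \<in> snd (graph_delta_matroid G). I \<subseteq> X \<and> X \<subseteq> S)}"
    using assms(2) by (auto simp: D indep[OF order_refl])
  have "?P S = (\<Union>T\<in>Pow S. maximal_sets (?P T))"
    by (auto simp: maximal_sets_def)
  also have "\<dots> = (\<Union>T\<in>Pow S. bases (?M T))" using bases by auto
  finally have 3: "graph_delta_matroid (induced_subgraph G S) = (S, \<Union>T\<in>Pow S. bases (?M T))"
    by (simp add: graph_delta_matroid_induced_subgraph[OF fin])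
  have "is_delta_matroid (graph_delta_matroid (induced_subgraph G S))"
    unfolding graph_delta_matroid_induced_subgraph[OF fin]
    using fin adj_matrix_sym by (rule is_delta_matroid_principal)
  with matroid 1 2 3 show ?thesis by blast
qed

end
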